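(* Let $\overline{G}$ be a geometric graph with underlying abstract graph $G$, in which any two distinct crossings are independent. Then $X(\overline{G}) \leq 3\chi(G)$.
   Context: Graphs are finite and simple. A geometric graph $\overline{G}$ is a simple graph $G$ drawn in the plane with vertices at distinct points in general position (no three collinear) and edges drawn as straight line segments. Two edges with no common endpoint cross if their segments intersect; a crossing of $\overline{G}$ is a pair of edges that cross, and the vertices of a crossing are the four endpoints of its two edges. Two crossings are independent if they have no vertices in common (equivalently, the minimum graph distance between a vertex of one and a vertex of the other is at least $1$). A geometric homomorphism $f:\overline{G}\to\overline{H}$ between geometric graphs is a map of vertex sets that sends adjacent vertices to adjacent vertices and sends each pair of crossing edges of $\overline{G}$ to a pair of crossing edges of $\overline{H}$. A geometric $n$-clique $\overline{K}_n$ is any geometric graph whose underlying abstract graph is the complete graph $K_n$. The geochromatic number $X(\overline{G})$ is the smallest positive integer $n$ such that there is a geometric homomorphism $\overline{G}\to\overline{K}_n$ for some geometric $n$-clique $\overline{K}_n$. $\chi(G)$ is the ordinary chromatic number of $G$. *)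

theory Defs
  imports "HOL-Analysis.Analysis"
begin

record 'a graph =
  verts :: "'a set"
  edges :: "'a set set"

text \<open>The null graph is excluded, since \<open>geochromatic_number\<close> below is positive by definition
  while the null graph has chromatic number 0.\<close>

definition simple_graph :: "'a graph \<Rightarrow> bool" where
  "simple_graph G \<longleftrightarrow>
     finite (verts G) \<and> verts G \<noteq> {} \<and> (\<forall>e\<in>edges G. e \<subseteq> verts G \<and> card e = 2)"

definition adjacent :: "'a graph \<Rightarrow> 'a \<Rightarrow> 'a \<Rightarrow> bool" where
  "adjacent G u v \<longleftrightarrow> {u, v} \<in> edges G"

definition proper_colouring :: "'a graph \<Rightarrow> nat \<Rightarrow> ('a \<Rightarrow> nat) \<Rightarrow> bool" where
  "proper_colouring G n c \<longleftrightarrow>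
     (\<forall>v\<in>verts G. c v < n) \<and>
     (\<forall>u\<in>verts G. \<forall>v\<in>verts G. adjacent G u v \<longrightarrow> c u \<noteq> c v)"

definition chromatic_number :: "'a graph \<Rightarrow> nat" where
  "chromatic_number G = (LEAST n. \<exists>c. proper_colouring G n c)"

text \<open>A geometric graph is an abstract graph \<open>G\<close> together with the placement \<open>p\<close> of its
  vertices; the placement determines the straight-line drawing.\<close>

definition geometric_graph :: "'a graph \<Rightarrow> ('a \<Rightarrow> real^2) \<Rightarrow> bool" where
  "geometric_graph G p \<longleftrightarrow>
     simple_graph G \<and> inj_on p (verts G) \<and>
     (\<forall>x\<in>verts G. \<forall>y\<in>verts G. \<forall>z\<in>verts G.
        x \<noteq> y \<and> y \<noteq> z \<and> x \<noteq> z \<longrightarrow> \<not> collinear {p x, p y, p z})"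

text \<open>For \<open>e = {u, v}\<close> this is the closed segment from \<open>p u\<close> to \<open>p v\<close>
  (fact \<open>segment_convex_hull\<close>).\<close>

definition edge_segment :: "('a \<Rightarrow> real^2) \<Rightarrow> 'a set \<Rightarrow> (real^2) set" where
  "edge_segment p e = convex hull (p ` e)"

definition edges_cross :: "('a \<Rightarrow> real^2) \<Rightarrow> 'a set \<Rightarrow> 'a set \<Rightarrow> bool" where
  "edges_cross p e f \<longleftrightarrow> e \<inter> f = {} \<and> edge_segment p e \<inter> edge_segment p f \<noteq> {}"

text \<open>A crossing is an unordered pair of edges.\<close>

definition crossings :: "'a graph \<Rightarrow> ('a \<Rightarrow> real^2) \<Rightarrow> 'a set set set" where
  "crossings G p = {{e, f} | e f. e \<in> edges G \<and> f \<in> edges G \<and> edges_cross p e f}"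

definition crossing_verts :: "'a set set \<Rightarrow> 'a set" where
  "crossing_verts c = \<Union> c"

definition independent_crossings :: "'a set set \<Rightarrow> 'a set set \<Rightarrow> bool" where
  "independent_crossings c d \<longleftrightarrow> crossing_verts c \<inter> crossing_verts d = {}"

definition geometric_hom ::
  "'a graph \<Rightarrow> ('a \<Rightarrow> real^2) \<Rightarrow> 'b graph \<Rightarrow> ('b \<Rightarrow> real^2) \<Rightarrow> ('a \<Rightarrow> 'b) \<Rightarrow> bool" where
  "geometric_hom G p H q h \<longleftrightarrow>
     h ` verts G \<subseteq> verts H \<and>
     (\<forall>u\<in>verts G. \<forall>v\<in>verts G. adjacent G u v \<longrightarrow> adjacent H (h u) (h v)) \<and>
     (\<forall>e f. {e, f} \<in> crossings G p \<longrightarrow> {h ` e, h ` f} \<in> crossings H q)"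

definition geometric_clique :: "nat \<Rightarrow> 'a graph \<Rightarrow> ('a \<Rightarrow> real^2) \<Rightarrow> bool" where
  "geometric_clique n K q \<longleftrightarrow>
     geometric_graph K q \<and> card (verts K) = n \<and>
     edges K = {e. e \<subseteq> verts K \<and> card e = 2}"

text \<open>The target cliques have vertices of type \<open>nat\<close>; this loses nothing, as finite graphs can be
  relabelled by natural numbers.\<close>

definition geochromatic_number :: "'a graph \<Rightarrow> ('a \<Rightarrow> real^2) \<Rightarrow> nat" where
  "geochromatic_number G p =
     (LEAST n. n > 0 \<and> (\<exists>(K :: nat graph) q h. geometric_clique n K q \<and> geometric_hom G p K q h))"

end

theory Submission
  imports Defs
begin

text \<open>Colour \<open>G\<close> properly with \<open>n\<close> colours, and take as target the clique whose \<open>3n\<close> vertices lie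
  in convex position, labelled around the curve with the colours \<open>0, \<dots>, n - 1\<close> three times over.
  A vertex of colour \<open>i\<close> may be sent to any of the three points labelled \<open>i\<close>; adjacent vertices have
  different labels and so, whatever the choice, different images.

  Hence only the crossings impose conditions, and as no vertex lies on two of them, the three-way
  choices can be made for each crossing separately. For one crossing, with colours \<open>i, j\<close> on one
  edge and \<open>k, l\<close> on the other, it remains to select points with these labels such that the two
  chords alternate along the curve; three rounds leave enough room for that even if the two edges
  have colours in common (\<open>colours_cross_ordered\<close>).

  The convex curve used is the parabola, where general position and the crossing of alternating
  chords reduce to the factorization of polynomials.\<close>

section \<open>Points on the parabola\<close>

definition parabola :: "nat \<Rightarrow> real^2" where
  "parabola m = vector [real m, (real m)\<^sup>2]"

lemma parabola_nth [simp]: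
  "parabola m $ 1 = real m" "parabola m $ 2 = (real m)\<^sup>2"
  by (simp_all add: parabola_def)

lemma inj_parabola: "inj parabola"
  by (metis injI of_nat_eq_iff parabola_nth(1))

text \<open>Two chords of the parabola that start in the same point have different slopes, the slope of
  the chord over \<open>x\<close> and \<open>y\<close> being \<open>x + y\<close>.\<close>

lemma not_collinear_parabola:
  assumes "x \<noteq> y" "y \<noteq> z" "x \<noteq> z"
  shows "\<not> collinear {parabola x, parabola y, parabola z}"
proof
  assume "collinear {parabola x, parabola y, parabola z}"
  then obtain u where u: "\<And>v w. v \<in> {parabola x, parabola y, parabola z} \<Longrightarrow>
      w \<in> {parabola x, parabola y, parabola z} \<Longrightarrow> \<exists>c. v - w = c *\<^sub>R u"
    unfolding collinear_def by blast
  obtain a where a: "parabola x - parabola y = a *\<^sub>R u" using u by blast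
  obtain b where b: "parabola y - parabola z = b *\<^sub>R u" using u by blast
  have a1: "real x - real y = a * u $ 1" and a2: "(real x)\<^sup>2 - (real y)\<^sup>2 = a * u $ 2"
    using arg_cong[OF a, of "\<lambda>v. v $ 1"] arg_cong[OF a, of "\<lambda>v. v $ 2"] by simp_all
  have b1: "real y - real z = b * u $ 1" and b2: "(real y)\<^sup>2 - (real z)\<^sup>2 = b * u $ 2"
    using arg_cong[OF b, of "\<lambda>v. v $ 1"] arg_cong[OF b, of "\<lambda>v. v $ 2"] by simp_all
  have "(real x - real y) * ((real y)\<^sup>2 - (real z)\<^sup>2) = ((real x)\<^sup>2 - (real y)\<^sup>2) * (real y - real z)"
    unfolding a1 a2 b1 b2 by simp
  then have "(real x - real y) * (real y - real z) * (real z - real x) = 0"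
    by algebra
  with assms show False by simp
qed

lemma edges_cross_commute: "edges_cross p e f \<longleftrightarrow> edges_cross p f e"
  by (auto simp: edges_cross_def)

text \<open>The line through the points of the parabola over \<open>a\<close> and \<open>b\<close> has the equation
  \<open>y = (a + b) x - a b\<close>.\<close>

lemma mem_parabola_chord:
  assumes ab: "a < b" and "real a \<le> x" "x \<le> real b"
  shows "(vector [x, (real a + real b) * x - real a * real b] :: real^2)
           \<in> edge_segment parabola {a, b}"
proof -
  define t where "t = (x - real a) / (real b - real a)"
  have t: "t * (real b - real a) = x - real a"
    using ab by (simp add: t_def)
  have "0 \<le> t" "t \<le> 1"
    using assms by (simp_all add: t_def)
  moreover have "vector [x, (real a + real b) * x - real a * real b] =
      (1 - t) *\<^sub>R parabola a + t *\<^sub>R parabola b"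
  proof -
    have "x = (1 - t) * real a + t * real b"
      using t by algebra
    moreover have "(real a + real b) * x - real a * real b = (1 - t) * (real a)\<^sup>2 + t * (real b)\<^sup>2"
      using t by algebra
    ultimately show ?thesis
      by (simp add: vec_eq_iff forall_2)
  qed
  ultimately have "vector [x, (real a + real b) * x - real a * real b] \<in>
      closed_segment (parabola a) (parabola b)"
    by (auto simp: in_segment)
  then show ?thesis
    by (simp add: edge_segment_def segment_convex_hull)
qed

lemma parabola_chords_cross:
  assumes "a < c" "c < b" "b < d"
  shows "edges_cross parabola {a, b} {c, d}"
proof -
  \<comment> \<open>\<open>D\<close> is the difference of the slopes, and \<open>x\<close> the abscissa of the common point of the two lines.
    Each of \<open>x - a\<close>, \<open>b - x\<close>, \<open>x - c\<close> is a product of two positive gaps, divided by \<open>D\<close>.\<close>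
  define D where "D = real c + real d - real a - real b"
  define x where "x = (real c * real d - real a * real b) / D"
  have D: "D > 0" using assms by (simp add: D_def)
  then have xD: "x * D = real c * real d - real a * real b"
    by (simp add: x_def)
  have "(x - real a) * D = (real c - real a) * (real d - real a)"
    unfolding left_diff_distrib xD by (simp add: D_def algebra_simps)
  then have "0 \<le> (x - real a) * D" using assms by simp
  then have a: "real a \<le> x" using D by (simp add: zero_le_mult_iff)
  have "(real b - x) * D = (real b - real c) * (real d - real b)"
    unfolding left_diff_distrib xD by (simp add: D_def algebra_simps)
  then have "0 \<le> (real b - x) * D" using assms by simp
  then have b: "x \<le> real b" using D by (simp add: zero_le_mult_iff)
  have "(x - real c) * D = (real c - real a) * (real b - real c)"
    unfolding left_diff_distrib xD by (simp add: D_def algebra_simps)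
  then have "0 \<le> (x - real c) * D" using assms by simp
  then have c: "real c \<le> x" using D by (simp add: zero_le_mult_iff)
  have "real b \<le> real d" using assms by simp
  with b have d: "x \<le> real d" by linarith
  have "(real a + real b) * x - real a * real b = (real c + real d) * x - real c * real d"
    using xD by (simp add: D_def algebra_simps)
  moreover have "a < b" "c < d" using assms by auto
  ultimately have "edge_segment parabola {a, b} \<inter> edge_segment parabola {c, d} \<noteq> {}"
    using mem_parabola_chord[of a b x] mem_parabola_chord[of c d x] a b c d by auto
  then show ?thesis
    using assms by (auto simp: edges_cross_def)
qed

section \<open>Choosing the rounds for one crossing\<close>

text \<open>The point of colour \<open>i\<close> in round \<open>r\<close> has number \<open>r * n + i\<close>, so that its position on the curve
  is determined lexicographically by round and colour.\<close>

lemma round_less: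
  fixes n i j r s :: nat
  assumes "r < s \<or> r = s \<and> i < j" "i < n"
  shows "r * n + i < s * n + j"
proof (cases "r < s")
  case True
  then have "Suc r * n \<le> s * n" by (intro mult_right_mono) auto
  with assms show ?thesis by simp
qed (use assms in auto)

definition colours_cross :: "nat \<Rightarrow> nat \<Rightarrow> nat \<Rightarrow> nat \<Rightarrow> nat \<Rightarrow> bool" where
  "colours_cross n i j k l \<longleftrightarrow> (\<exists>r s t u. r < 3 \<and> s < 3 \<and> t < 3 \<and> u < (3::nat) \<and>
     edges_cross parabola {r * n + i, s * n + j} {t * n + k, u * n + l})"

lemma colours_cross_swap:
  "colours_cross n i j k l \<longleftrightarrow> colours_cross n k l i j"
  unfolding colours_cross_def using edges_cross_commute[of parabola] by blast

lemma colours_cross_flip: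
  "colours_cross n i j k l \<longleftrightarrow> colours_cross n j i k l"
  unfolding colours_cross_def
  by (subst insert_commute) blast

text \<open>After the symmetries above, \<open>i < j\<close>, \<open>k < l\<close> and \<open>i \<le> k\<close>. Then \<open>i\<close> in round 0, \<open>k\<close> in
  round 1, the next available \<open>j\<close>, and \<open>l\<close> in round 2 are met in this order: if \<open>j\<close> has to wait
  for round 2, then \<open>j \<le> k < l\<close>.\<close>

lemma colours_cross_ordered:
  assumes "i < j" "k < l" "i \<le> k" "j < n" "l < n"
  shows "colours_cross n i j k l"
proof -
  define s :: nat where "s = (if k < j then 1 else 2)"
  have "edges_cross parabola {0 * n + i, s * n + j} {1 * n + k, 2 * n + l}"
    by (intro parabola_chords_cross round_less) (use assms in \<open>auto simp: s_def\<close>)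
  moreover have "s < 3" by (simp add: s_def)
  ultimately show ?thesis
    unfolding colours_cross_def
    by (intro exI[of _ 0] exI[of _ s] exI[of _ 1] exI[of _ 2]) auto
qed

lemma colours_cross:
  assumes "i \<noteq> j" "k \<noteq> l" "i < n" "j < n" "k < n" "l < n"
  shows "colours_cross n i j k l"
proof -
  have increasing: "colours_cross n i j k l" if "i < j" "k < l" "j < n" "l < n" for i j k l
    using that colours_cross_ordered[of i j k l n] colours_cross_ordered[of k l i j n]
      colours_cross_swap[of n i j k l]
    by (cases "i \<le> k") auto
  have first_increasing: "colours_cross n i j k l" if "i < j" "j < n" for i j
    using that assms increasing[of i j k l] increasing[of i j l k]
      colours_cross_swap[of n i j] colours_cross_flip[of n k l i j]
    by (cases "k < l") auto
  show ?thesis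
    using assms first_increasing[of i j] first_increasing[of j i] colours_cross_flip[of n i j k l]
    by (cases "i < j") auto
qed

section \<open>From colourings to homomorphisms\<close>

lemma simple_graph_edgeE:
  assumes "simple_graph G" "e \<in> edges G"
  obtains u v where "e = {u, v}" "u \<noteq> v" "u \<in> verts G" "v \<in> verts G"
proof -
  have e: "e \<subseteq> verts G" "card e = 2"
    using assms by (simp_all add: simple_graph_def)
  obtain u v where "e = {u, v}" "u \<noteq> v"
    using e(2) unfolding card_2_iff by blast
  with e(1) show ?thesis
    by (intro that[of u v]) simp_all
qed

lemma chromatic_number_colouring:
  assumes "simple_graph G"
  obtains c where "proper_colouring G (chromatic_number G) c"
proof -
  have "finite (verts G)" using assms by (simp add: simple_graph_def)
  from finite_imp_inj_to_nat_seg[OF this]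
  obtain f :: "'a \<Rightarrow> nat" and n where f: "f ` verts G = {i. i < n}" "inj_on f (verts G)"
    by (elim exE conjE)
  have "u \<noteq> v" if "adjacent G u v" for u v
  proof -
    have "card {u, v} = 2"
      using that assms unfolding adjacent_def simple_graph_def by blast
    then show ?thesis by auto
  qed
  moreover have "f v < n" if "v \<in> verts G" for v
    using f(1) that by blast
  ultimately have "proper_colouring G n f"
    using f(2) unfolding proper_colouring_def by (simp add: inj_on_eq_iff)
  then have "\<exists>c. proper_colouring G (chromatic_number G) c"
    unfolding chromatic_number_def
    by (rule LeastI[where P = "\<lambda>n. \<exists>c. proper_colouring G n c", OF exI])
  then show ?thesis by (elim exE that)
qed

definition parabola_clique :: "nat \<Rightarrow> nat graph" where
  "parabola_clique m = \<lparr>verts = {..<m}, edges = {e. e \<subseteq> {..<m} \<and> card e = 2}\<rparr>"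

lemma parabola_clique_sel [simp]:
  "verts (parabola_clique m) = {..<m}"
  "edges (parabola_clique m) = {e. e \<subseteq> {..<m} \<and> card e = 2}"
  by (simp_all add: parabola_clique_def)

lemma geometric_clique_parabola:
  assumes "m > 0"
  shows "geometric_clique m (parabola_clique m) parabola"
proof -
  have "simple_graph (parabola_clique m)"
    using assms by (auto simp: simple_graph_def)
  moreover have "inj_on parabola {..<m}"
    using inj_parabola by (rule inj_on_subset) simp
  ultimately show ?thesis
    by (simp add: geometric_clique_def geometric_graph_def not_collinear_parabola)
qed

text \<open>Here \<open>c v\<close> is the colour and \<open>s v\<close> the round of the vertex \<open>v\<close>.\<close>

definition place :: "nat \<Rightarrow> ('a \<Rightarrow> nat) \<Rightarrow> ('a \<Rightarrow> nat) \<Rightarrow> 'a \<Rightarrow> nat" where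
  "place n c s v = s v * n + c v"

lemma place_less:
  assumes "c v < n" "s v < 3"
  shows "place n c s v < 3 * n"
  using round_less[of "s v" 3 "c v" 0 n] assms by (simp add: place_def)

lemma place_neq:
  assumes "c u < n" "c v < n" "c u \<noteq> c v"
  shows "place n c s u \<noteq> place n c s v"
proof
  assume "place n c s u = place n c s v"
  then have "(s u * n + c u) mod n = (s v * n + c v) mod n"
    by (simp add: place_def)
  with assms show False by simp
qed

text \<open>Disjointness of the two edges of a crossing makes the rounds of the four vertices independent
  of each other.\<close>

lemma exists_rounds_for_crossing:
  assumes G: "simple_graph G" and c: "proper_colouring G n c" and X: "X \<in> crossings G p"
  shows "\<exists>s. (\<forall>v. s v < 3) \<and>
    (\<forall>e f. X = {e, f} \<longrightarrow> edges_cross parabola (place n c s ` e) (place n c s ` f))"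
proof -
  obtain e f where ef: "X = {e, f}" "e \<in> edges G" "f \<in> edges G" "e \<inter> f = {}"
    using X by (auto simp: crossings_def edges_cross_def)
  obtain a b where ab: "e = {a, b}" "a \<noteq> b" and vs_ab: "a \<in> verts G" "b \<in> verts G"
    using G ef(2) by (rule simple_graph_edgeE)
  obtain x y where xy: "f = {x, y}" "x \<noteq> y" and vs_xy: "x \<in> verts G" "y \<in> verts G"
    using G ef(3) by (rule simple_graph_edgeE)
  have "c a \<noteq> c b" "c x \<noteq> c y" "c a < n" "c b < n" "c x < n" "c y < n"
    using c vs_ab vs_xy ef ab xy by (auto simp: proper_colouring_def adjacent_def)
  then obtain r s t u where less: "r < 3" "s < 3" "t < 3" "u < (3::nat)"
    and cross: "edges_cross parabola {r * n + c a, s * n + c b} {t * n + c x, u * n + c y}"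
    using colours_cross[of "c a" "c b" "c x" "c y" n]
    unfolding colours_cross_def by blast
  define g where "g = (\<lambda>_. 0)(a := r, b := s, x := t, y := u)"
  have "place n c g ` e = {r * n + c a, s * n + c b}" "place n c g ` f = {t * n + c x, u * n + c y}"
    using ab xy ef(4) by (auto simp: place_def g_def)
  with cross have "edges_cross parabola (place n c g ` e) (place n c g ` f)" by simp
  then have "edges_cross parabola (place n c g ` e') (place n c g ` f')" if "X = {e', f'}" for e' f'
    using that ef(1) edges_cross_commute[of parabola] by (auto simp: doubleton_eq_iff)
  moreover have "g v < 3" for v
    using less by (simp add: g_def)
  ultimately show ?thesis by blast
qed

text \<open>By independence a vertex determines the crossing that it lies on, so that the choices of
  rounds for the different crossings combine.\<close>

lemma exists_rounds:
  assumes G: "simple_graph G" and c: "proper_colouring G n c"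
    and indep: "\<forall>X\<in>crossings G p. \<forall>Y\<in>crossings G p. X \<noteq> Y \<longrightarrow> independent_crossings X Y"
  obtains s where "\<And>v. s v < 3"
    and "\<And>e f. {e, f} \<in> crossings G p \<Longrightarrow>
      edges_cross parabola (place n c s ` e) (place n c s ` f)"
proof -
  let ?good = "\<lambda>X s. (\<forall>v. s v < 3) \<and>
    (\<forall>e f. X = {e, f} \<longrightarrow> edges_cross parabola (place n c s ` e) (place n c s ` f))"
  have "\<forall>X\<in>crossings G p. \<exists>s. ?good X s"
    by (intro ballI exists_rounds_for_crossing[OF G c])
  then have "\<exists>S. \<forall>X\<in>crossings G p. ?good X (S X)"
    by (rule bchoice)
  then obtain S where S: "\<forall>X\<in>crossings G p. ?good X (S X)"
    by (rule exE)
  define crossing_of where "crossing_of v = (SOME X. X \<in> crossings G p \<and> v \<in> \<Union>X)" for v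
  define s where "s v = (if crossing_of v \<in> crossings G p then S (crossing_of v) v else 0)" for v
  have crossing_of: "crossing_of v = X" if "X \<in> crossings G p" "v \<in> \<Union>X" for v X
  proof -
    have "crossing_of v \<in> crossings G p \<and> v \<in> \<Union>(crossing_of v)"
      unfolding crossing_of_def by (rule someI[of _ X]) (use that in blast)
    then have "crossing_of v \<in> crossings G p" and "\<not> independent_crossings (crossing_of v) X"
      using that by (auto simp: independent_crossings_def crossing_verts_def)
    then show ?thesis
      using that(1) indep by auto
  qed
  have "edges_cross parabola (place n c s ` e) (place n c s ` f)" if ef: "{e, f} \<in> crossings G p"
    for e f
  proof -
    have "place n c s v = place n c (S {e, f}) v" if "v \<in> e \<union> f" for v
      using crossing_of[OF ef, of v] that ef by (simp add: place_def s_def)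
    then have "place n c s ` e = place n c (S {e, f}) ` e"
      "place n c s ` f = place n c (S {e, f}) ` f"
      by auto
    with bspec[OF S ef] show ?thesis by simp
  qed
  moreover have "s v < 3" for v
    using S by (simp add: s_def)
  ultimately show ?thesis
    by (rule that[rotated])
qed

lemma geometric_hom_place:
  assumes G: "simple_graph G" and c: "proper_colouring G n c" and s: "\<And>v. s v < 3"
    and cross: "\<And>e f. {e, f} \<in> crossings G p \<Longrightarrow>
      edges_cross parabola (place n c s ` e) (place n c s ` f)"
  shows "geometric_hom G p (parabola_clique (3 * n)) parabola (place n c s)"
proof -
  have less: "place n c s v < 3 * n" if "v \<in> verts G" for v
    using c that s by (intro place_less) (auto simp: proper_colouring_def)
  have adj: "adjacent (parabola_clique (3 * n)) (place n c s u) (place n c s v)"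
    if uv: "u \<in> verts G" "v \<in> verts G" "adjacent G u v" for u v
  proof -
    have "place n c s u \<noteq> place n c s v"
      using c uv by (intro place_neq) (auto simp: proper_colouring_def)
    then show ?thesis
      using less uv by (simp add: adjacent_def)
  qed
  have edge: "place n c s ` e \<in> edges (parabola_clique (3 * n))" if e: "e \<in> edges G" for e
  proof -
    obtain u v where uv: "e = {u, v}" "u \<in> verts G" "v \<in> verts G"
      using G e by (rule simple_graph_edgeE)
    with adj[of u v] e show ?thesis
      by (auto simp: adjacent_def)
  qed
  have "{place n c s ` e, place n c s ` f} \<in> crossings (parabola_clique (3 * n)) parabola"
    if ef: "{e, f} \<in> crossings G p" for e f
  proof -
    have "e \<in> edges G" "f \<in> edges G"
      using ef by (auto simp: crossings_def doubleton_eq_iff)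
    then show ?thesis
      unfolding crossings_def using edge cross[OF ef] by blast
  qed
  then show ?thesis
    using less adj by (auto simp: geometric_hom_def)
qed

theorem theorem5:
  fixes G :: "'a graph" and p :: "'a \<Rightarrow> real^2"
  assumes "geometric_graph G p"
    and "\<forall>c\<in>crossings G p. \<forall>d\<in>crossings G p. c \<noteq> d \<longrightarrow> independent_crossings c d"
  shows "geochromatic_number G p \<le> 3 * chromatic_number G"
proof -
  define n where "n = chromatic_number G"
  have G: "simple_graph G" using assms(1) by (simp add: geometric_graph_def)
  then obtain c where c: "proper_colouring G n c"
    unfolding n_def by (rule chromatic_number_colouring)
  obtain v where "v \<in> verts G" using G by (auto simp: simple_graph_def)
  then have "c v < n" using c by (simp add: proper_colouring_def)
  then have pos: "3 * n > 0" by simp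
  obtain s where "\<And>v. s v < 3" "\<And>e f. {e, f} \<in> crossings G p \<Longrightarrow>
      edges_cross parabola (place n c s ` e) (place n c s ` f)"
    using exists_rounds[OF G c assms(2)] by blast
  then have "geometric_hom G p (parabola_clique (3 * n)) parabola (place n c s)"
    by (intro geometric_hom_place[OF G c])
  with pos geometric_clique_parabola[OF pos] show ?thesis
    unfolding geochromatic_number_def n_def[symmetric] by (intro Least_le) blast
qed

end
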